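(* Let $\alpha,\beta>0$ with $\alpha\beta=4\pi^3$. For $0<a<1$, \begin{align*} \sum_{n=1}^{\infty}\frac{\exp(-an^2\alpha)}{1-\exp(-n^2\alpha)}&=\frac{1}{2}\left(a-\frac{1}{2}\right)+\frac{\pi^2}{6\alpha}+\frac{\sqrt{\pi}}{2\sqrt{\alpha}}\bigg\{\sum_{n=1}^{\infty}\frac{\cos(2\pi na)}{\sqrt{n}}\left(\frac{\sinh(\sqrt{n\beta})-\sin(\sqrt{n\beta})}{\cosh(\sqrt{n\beta})-\cos(\sqrt{n\beta})}\right)\\ &\qquad+\sum_{n=1}^{\infty}\frac{\sin(2\pi na)}{\sqrt{n}}\left(\frac{\sinh(\sqrt{n\beta})+\sin(\sqrt{n\beta})}{\cosh(\sqrt{n\beta})-\cos(\sqrt{n\beta})}\right)\bigg\}. \end{align*} In particular, \[ \sum_{n=1}^{\infty}\mathrm{cosech}\left(\frac{n^2\alpha}{2}\right)=\frac{\pi^2}{3\alpha}+\sqrt{\frac{\pi}{\alpha}}\sum_{n=1}^{\infty}\frac{(-1)^n}{\sqrt{n}}\left(\frac{\sinh(\sqrt{n\beta})-\sin(\sqrt{n\beta})}{\cosh(\sqrt{n\beta})-\cos(\sqrt{n\beta})}\right). \] *)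

theory Defs
  imports "HOL-Analysis.Analysis"
begin

end

theory Submission
  imports Defs
begin

text \<open>
  For fixed \<open>x > 0\<close> and \<open>0 < a < 1\<close>, the Fourier expansion in \<open>a\<close>
  \[ \frac{e^{-ax}}{1-e^{-x}} = \sum_{k\in Z} \frac{e^{2\pi i k a}}{x+2\pi i k} \]
  is summed over \<open>x = m\<^sup>2\<alpha>\<close>. The inner sums over \<open>m\<close> are evaluated by the partial fractions of
  \<open>coth\<close> at \<open>\<pi>c\<close> with \<open>c\<^sup>2 = 2\<pi>ik/\<alpha>\<close>: the \<open>coth\<close> part gives the two trigonometric series, the
  rational part a sawtooth series, and \<open>k = 0\<close> gives \<open>\<pi>\<^sup>2/(6\<alpha>)\<close>. The \<open>k\<close>-series converges only
  conditionally; Abel summation bounds its partial sums by \<open>O(1/x)\<close> uniformly, which is summable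
  over \<open>m\<close>, so Tannery's theorem justifies the interchange. This gives the sum of the two series
  together; the substitution \<open>a \<mapsto> 1 - a\<close> fixes the cosine series and negates the sine series,
  which separates them.
\<close>

section \<open>Complex partial fractions of cot and coth\<close>

text \<open>Logarithmic derivative of the reflection formula:
  \<open>rGamma z * rGamma (1 - z)\<close> and \<open>sin (pi * z) / pi\<close> are the same
  function, so their derivatives agree, and \<open>sin (pi * z)\<close> is nonzero off the integers
  and can be divided out.\<close>

lemma Digamma_reflection_complex:
  fixes z :: complex
  assumes "z \<notin> \<int>"
  shows "Digamma (1 - z) - Digamma z = of_real pi * cot (of_real pi * z)"
proof -
  have z: "z \<notin> \<int>\<^sub>\<le>\<^sub>0" "1 - z \<notin> \<int>\<^sub>\<le>\<^sub>0"
    using assms by (auto dest: nonpos_Ints_Int)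
  have "((\<lambda>z. rGamma z * rGamma (1 - z)) has_field_derivative
      rGamma z * rGamma (1 - z) * (Digamma (1 - z) - Digamma z)) (at z)"
    using z by (auto intro!: derivative_eq_intros simp: algebra_simps)
  moreover have "(\<lambda>z. rGamma z * rGamma (1 - z)) = (\<lambda>z. sin (of_real pi * z) / of_real pi :: complex)"
    by (intro ext rGamma_reflection_complex)
  moreover have "((\<lambda>z. sin (of_real pi * z) / of_real pi) has_field_derivative cos (of_real pi * z)) (at z)"
    by (auto intro!: derivative_eq_intros)
  ultimately have "sin (of_real pi * z) / of_real pi * (Digamma (1 - z) - Digamma z) = cos (of_real pi * z)"
    by (metis DERIV_unique rGamma_reflection_complex)
  moreover have "sin (of_real pi * z) \<noteq> 0"
    using assms z rGamma_eq_zero_iff[of z] rGamma_eq_zero_iff[of "1 - z"] rGamma_reflection_complex[of z]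
    by (metis divide_eq_0_iff mult_eq_0_iff)
  ultimately show ?thesis
    by (simp add: cot_def field_simps)
qed

text \<open>Each term splits as \<open>1/(z + n + 1) - 1/(1 - z + n)\<close>, so the partial sums
  are differences of the sequences that define \<open>Digamma (1 - z)\<close> and
  \<open>Digamma z\<close>; the reflection formula evaluates the limit.\<close>

lemma cot_partial_fractions:
  fixes z :: complex
  assumes "z \<notin> \<int>"
  shows "(\<lambda>n. 2 * z / (z\<^sup>2 - (of_nat (Suc n))\<^sup>2)) sums (of_real pi * cot (of_real pi * z) - 1 / z)"
proof -
  have nz: "z + of_nat n \<noteq> 0" "1 - z + of_nat n \<noteq> 0" for n
  proof -
    show "z + of_nat n \<noteq> 0" using assms by (metis Ints_minus Ints_of_nat add_eq_0_iff2)
    have "z \<noteq> of_nat (Suc n)" using assms by (metis Ints_of_nat)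
    thus "1 - z + of_nat n \<noteq> 0" by (auto simp: algebra_simps)
  qed
  have "z \<noteq> 0" "1 - z \<noteq> 0" using assms by auto
  \<comment> \<open>The two logarithms cancel and are inserted only to match
    \<open>Digamma_LIMSEQ\<close>. Shifting \<open>z + n + 1\<close> to \<open>z + n\<close>
    produces the terms \<open>- 1 / z\<close> and \<open>inverse (z + m)\<close>.\<close>
  have partial: "(\<Sum>n<m. 2 * z / (z\<^sup>2 - (of_nat (Suc n))\<^sup>2)) =
     (of_real (ln (real m)) - (\<Sum>n<m. inverse (1 - z + of_nat n)))
     - (of_real (ln (real m)) - (\<Sum>n<m. inverse (z + of_nat n))) - 1 / z + inverse (z + of_nat m)" for m
  proof (induction m)
    case (Suc m)
    have "z\<^sup>2 - (of_nat (Suc m))\<^sup>2 = - ((1 - z + of_nat m) * (z + of_nat (Suc m)))"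
      by (simp add: power2_eq_square algebra_simps)
    hence "2 * z / (z\<^sup>2 - (of_nat (Suc m))\<^sup>2) = inverse (z + of_nat (Suc m)) - inverse (1 - z + of_nat m)"
      using nz[of m] nz(1)[of "Suc m"] by (simp add: divide_simps)
    thus ?case using Suc by simp
  qed (use \<open>z \<noteq> 0\<close> in \<open>auto simp: field_simps\<close>)
  have "(\<lambda>m. inverse (z + of_nat m)) \<longlonglongrightarrow> 0"
    by (intro tendsto_inverse_0[THEN filterlim_compose] tendsto_add_filterlim_at_infinity[OF tendsto_const]
        tendsto_of_nat)
  hence "(\<lambda>m. \<Sum>n<m. 2 * z / (z\<^sup>2 - (of_nat (Suc n))\<^sup>2)) \<longlonglongrightarrow>
      Digamma (1 - z) - Digamma z - 1 / z + 0"
    unfolding partial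
    by (intro tendsto_add tendsto_diff Digamma_LIMSEQ tendsto_const \<open>z \<noteq> 0\<close> \<open>1 - z \<noteq> 0\<close>)
  thus ?thesis
    using Digamma_reflection_complex[OF assms] by (simp add: sums_def)
qed

text \<open>The cotangent expansion rotated to \<open>z = i c\<close>; the factor
  \<open>i / (2 c)\<close> turns the numerator \<open>2 z\<close> into -1, which absorbs the sign of
  \<open>z^2 - n^2 = -(n^2 + c^2)\<close>.\<close>

lemma coth_partial_fractions:
  fixes c :: complex
  assumes "\<i> * c \<notin> \<int>"
  shows "(\<lambda>n. 1 / ((of_nat (Suc n))\<^sup>2 + c\<^sup>2)) sums
    ((of_real pi * c * cosh (of_real pi * c) / sinh (of_real pi * c) - 1) / (2 * c\<^sup>2))"
proof -
  have "c \<noteq> 0" using assms by auto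
  have "(\<lambda>n. \<i> / (2 * c) * (2 * (\<i> * c) / ((\<i> * c)\<^sup>2 - (of_nat (Suc n))\<^sup>2))) sums
      (\<i> / (2 * c) * (of_real pi * cot (of_real pi * (\<i> * c)) - 1 / (\<i> * c)))"
    by (intro sums_mult cot_partial_fractions assms)
  moreover have "\<i> / (2 * c) * (2 * (\<i> * c) / ((\<i> * c)\<^sup>2 - (of_nat (Suc n))\<^sup>2)) =
      1 / ((of_nat (Suc n))\<^sup>2 + c\<^sup>2)" for n
  proof -
    have "(\<i> * c)\<^sup>2 - (of_nat (Suc n))\<^sup>2 = - ((of_nat (Suc n))\<^sup>2 + c\<^sup>2)"
      by (simp add: power_mult_distrib)
    moreover have "\<i> / (2 * c) * (2 * (\<i> * c) / - X) = 1 / X" for X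
      using \<open>c \<noteq> 0\<close> by simp
    ultimately show ?thesis by metis
  qed
  moreover have "\<i> / (2 * c) * (of_real pi * cot (of_real pi * (\<i> * c)) - 1 / (\<i> * c)) =
      (of_real pi * c * cosh (of_real pi * c) / sinh (of_real pi * c) - 1) / (2 * c\<^sup>2)"
  proof -
    have "cot (of_real pi * (\<i> * c)) = cosh (of_real pi * c) / (\<i> * sinh (of_real pi * c))"
      by (simp add: cot_def cosh_conv_cos sinh_conv_sin mult_ac)
    thus ?thesis using \<open>c \<noteq> 0\<close> by (simp add: field_simps power2_eq_square)
  qed
  ultimately show ?thesis by simp
qed

section \<open>Transport of Fourier partial sums from 1/2 to a\<close>

text \<open>The terms with indices \<open>\<plusminus>(n+1)\<close> of the Fourier expansion, added up.\<close>
definition fourier_exp_term :: "real \<Rightarrow> real \<Rightarrow> nat \<Rightarrow> real" where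
  "fourier_exp_term x a n =
     2 * (x * cos (2*pi*real (Suc n)*a) + 2*pi*real (Suc n) * sin (2*pi*real (Suc n)*a)) /
     (x\<^sup>2 + (2*pi*real (Suc n))\<^sup>2)"

text \<open>Telescopes, because \<open>2 sin (pi t) cos (2 pi k t)\<close> is a difference of sines
  at consecutive odd multiples of \<open>pi t\<close>.\<close>

lemma Dirichlet_kernel:
  "sin (pi * t) * (1 + (\<Sum>n<N. 2 * cos (2*pi*real (Suc n)*t))) = sin ((2 * real N + 1) * pi * t)"
proof (induction N)
  case (Suc N)
  have "2 * (sin (pi * t) * cos (2*pi*real (Suc N)*t)) =
      sin ((2 * real (Suc N) + 1) * pi * t) - sin ((2 * real N + 1) * pi * t)"
  proof -
    have "(2 * real (Suc N) + 1) * pi * t = 2*pi*real (Suc N)*t + pi * t"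
         "(2 * real N + 1) * pi * t = 2*pi*real (Suc N)*t - pi * t"
      by (simp_all add: algebra_simps)
    thus ?thesis by (simp only: sin_add sin_diff) (simp add: algebra_simps)
  qed
  thus ?case using Suc by (simp add: algebra_simps)
qed simp

text \<open>As a function of t, the term solves \<open>y' + x y = 2 cos (k t)\<close>, with
  integrating factor \<open>exp (x t)\<close>. The case x = 0, which yields the sawtooth series, is
  included since the denominator is at least \<open>k^2 > 0\<close>.\<close>

lemma fourier_exp_term_deriv:
  "((\<lambda>t. exp (x * t) * fourier_exp_term x t n) has_real_derivative
      exp (x * t) * (2 * cos (2*pi*real (Suc n)*t))) (at t within S)"
proof -
  define k where "k = 2 * pi * real (Suc n)"
  have nz: "x\<^sup>2 + k\<^sup>2 \<noteq> 0"
    by (auto simp: k_def sum_power2_eq_zero_iff)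
  have "((\<lambda>t. exp (x * t) * (2 * (x * cos (k * t) + k * sin (k * t)) / (x\<^sup>2 + k\<^sup>2))) has_real_derivative
      exp (x * t) * (2 * cos (k * t))) (at t within S)"
    by (rule derivative_eq_intros refl nz)+
       (use nz in \<open>simp add: divide_simps\<close>, simp add: algebra_simps power2_eq_square)
  thus ?thesis by (simp only: fourier_exp_term_def k_def)
qed

text \<open>
  \<open>e\<^sup>x\<^sup>t\<close> times the partial sum, plus \<open>E\<close>, has derivative \<open>e\<^sup>x\<^sup>t sin(Mt)/sin(\<pi>t)\<close> with \<open>M = (2N+1)\<pi>\<close>.
  The corrector \<open>R\<close> is the boundary term of an integration by parts; it leaves a derivative of size
  \<open>O(1/M)\<close> between \<open>1/2\<close> and \<open>a\<close>, where \<open>sin(\<pi>t)\<close> has no zero.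
\<close>
lemma fourier_exp_partial_sum_transport:
  fixes E :: "real \<Rightarrow> real"
  assumes a: "0 < a" "a < 1"
    and E: "\<And>t. (E has_real_derivative exp (x * t)) (at t)"
  shows "(\<lambda>N. (exp (x * a) * (\<Sum>n<N. fourier_exp_term x a n) + E a)
             - (exp (x * (1/2)) * (\<Sum>n<N. fourier_exp_term x (1/2) n) + E (1/2))) \<longlonglongrightarrow> 0"
proof -
  define I where "I = {min a (1/2)..max a (1/2)}"
  have sin_pos: "sin (pi * t) > 0" if "t \<in> I" for t
  proof -
    have "0 < t" "t < 1" using that a by (auto simp: I_def min_def max_def split: if_splits)
    thus ?thesis by (intro sin_gt_zero) auto
  qed
  \<comment> \<open>\<open>D\<close> is the derivative of \<open>exp (x t) / sin (pi t)\<close>. As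
    \<open>R\<close> is this quotient times \<open>cos (M t) / M\<close>, differentiating the cosine
    cancels the derivative of \<open>Q\<close> and leaves \<open>cos (M t) / M * D\<close>.\<close>
  define D where "D = (\<lambda>t. (x * exp (x * t) * sin (pi * t) - pi * cos (pi * t) * exp (x * t)) / (sin (pi * t))\<^sup>2)"
  have "continuous_on I D"
    unfolding D_def using sin_pos by (intro continuous_intros) force+
  hence "bounded (D ` I)"
    by (intro compact_imp_bounded compact_continuous_image) (auto simp: I_def)
  then obtain B where B: "\<And>t. t \<in> I \<Longrightarrow> \<bar>D t\<bar> \<le> B"
    by (auto simp: bounded_iff)
  define M where "M = (\<lambda>N. (2 * real N + 1) * pi)"
  have M: "M N > 0" for N by (simp add: M_def add_pos_nonneg mult_pos_pos)
  define Q where "Q = (\<lambda>N t. exp (x * t) * (\<Sum>n<N. fourier_exp_term x t n) + E t)"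
  define R where "R = (\<lambda>N t. exp (x * t) * cos (M N * t) / (M N * sin (pi * t)))"
  have deriv: "((\<lambda>t. Q N t + R N t) has_real_derivative (cos (M N * t) / M N * D t)) (at t within I)"
    if t: "t \<in> I" for N t
  proof -
    have "(E has_real_derivative exp (x * t)) (at t within I)"
      using E by (rule has_field_derivative_at_within)
    moreover have "((\<lambda>t. exp (x * t) * (\<Sum>n<N. fourier_exp_term x t n)) has_real_derivative
        (\<Sum>n<N. exp (x * t) * (2 * cos (2*pi*real (Suc n)*t)))) (at t within I)"
      unfolding sum_distrib_left by (intro DERIV_sum fourier_exp_term_deriv)
    ultimately have "(Q N has_real_derivative
        (\<Sum>n<N. exp (x * t) * (2 * cos (2*pi*real (Suc n)*t))) + exp (x * t)) (at t within I)"
      unfolding Q_def by (intro DERIV_add)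
    also have "(\<Sum>n<N. exp (x * t) * (2 * cos (2*pi*real (Suc n)*t))) + exp (x * t) =
        exp (x * t) * sin (M N * t) / sin (pi * t)"
    proof -
      have "(\<Sum>n<N. exp (x * t) * (2 * cos (2*pi*real (Suc n)*t))) + exp (x * t) =
          exp (x * t) * (1 + (\<Sum>n<N. 2 * cos (2*pi*real (Suc n)*t)))"
        by (simp only: sum_distrib_left [symmetric]) (simp add: distrib_left)
      also have "1 + (\<Sum>n<N. 2 * cos (2*pi*real (Suc n)*t)) = sin (M N * t) / sin (pi * t)"
        using sin_pos[OF t] Dirichlet_kernel[of t N] by (simp only: M_def) (simp add: eq_divide_eq mult.commute)
      finally show ?thesis by simp
    qed
    finally have Q': "(Q N has_real_derivative exp (x * t) * sin (M N * t) / sin (pi * t)) (at t within I)" .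
    have nz: "M N * sin (pi * t) \<noteq> 0" using M[of N] sin_pos[OF t] by simp
    have R': "(R N has_real_derivative
        (cos (M N * t) / M N * D t - exp (x * t) * sin (M N * t) / sin (pi * t))) (at t within I)"
      unfolding R_def
      by (rule derivative_eq_intros refl nz)+
         (use nz in \<open>simp add: D_def divide_simps\<close>, simp add: algebra_simps power2_eq_square)
    from DERIV_add[OF Q' R'] show ?thesis by simp
  qed
  \<comment> \<open>Mean value inequality on the interval between a and 1/2.\<close>
  have bound: "\<bar>(Q N a + R N a) - (Q N (1/2) + R N (1/2))\<bar> \<le> B / M N * \<bar>a - 1/2\<bar>" for N
    unfolding real_norm_def [symmetric]
  proof (rule field_differentiable_bound[OF _ deriv])
    fix t assume t: "t \<in> I"
    have "\<bar>cos (M N * t)\<bar> * \<bar>D t\<bar> \<le> 1 * B"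
      using B[OF t] by (intro mult_mono) auto
    thus "norm (cos (M N * t) / M N * D t) \<le> B / M N"
      using M[of N] by (simp add: abs_mult divide_right_mono)
  qed (auto simp: I_def)
  have M_lim: "filterlim M at_top sequentially"
  proof (rule filterlim_at_top_mono[OF filterlim_real_sequentially])
    have "real N * 1 \<le> (2 * real N + 1) * pi" for N
      using pi_ge_two by (intro mult_mono) auto
    thus "\<forall>\<^sub>F N in sequentially. real N \<le> M N" by (simp add: M_def)
  qed
  have "(\<lambda>N. (Q N a + R N a) - (Q N (1/2) + R N (1/2))) \<longlonglongrightarrow> 0"
  proof (rule Lim_null_comparison)
    show "\<forall>\<^sub>F N in sequentially. norm ((Q N a + R N a) - (Q N (1/2) + R N (1/2))) \<le> B / M N * \<bar>a - 1/2\<bar>"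
      using bound by simp
    show "(\<lambda>N. B / M N * \<bar>a - 1/2\<bar>) \<longlonglongrightarrow> 0"
      using tendsto_mult_left_zero[OF tendsto_divide_0[OF tendsto_const filterlim_at_top_imp_at_infinity[OF M_lim]]]
      by blast
  qed
  \<comment> \<open>The corrector itself is O(1/M) at both endpoints, so it can be removed in the
    limit.\<close>
  moreover have "(\<lambda>N. R N t) \<longlonglongrightarrow> 0" if "t \<in> I" for t
  proof (rule Lim_null_comparison)
    have "norm (R N t) \<le> exp (x * t) / sin (pi * t) / M N" for N
      using M[of N] sin_pos[OF that] by (simp add: R_def abs_mult divide_simps)
    thus "\<forall>\<^sub>F N in sequentially. norm (R N t) \<le> exp (x * t) / sin (pi * t) / M N"
      by simp
    show "(\<lambda>N. exp (x * t) / sin (pi * t) / M N) \<longlonglongrightarrow> 0"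
      by (rule tendsto_divide_0[OF tendsto_const filterlim_at_top_imp_at_infinity[OF M_lim]])
  qed
  hence "(\<lambda>N. R N a - R N (1/2)) \<longlonglongrightarrow> 0 - 0"
    by (intro tendsto_diff) (auto simp: I_def)
  ultimately have "(\<lambda>N. ((Q N a + R N a) - (Q N (1/2) + R N (1/2))) - (R N a - R N (1/2))) \<longlonglongrightarrow> 0 - (0 - 0)"
    by (rule tendsto_diff)
  thus ?thesis by (simp add: Q_def add_diff_add)
qed

section \<open>Uniform bound for the partial sums\<close>

text \<open>Multiplying by \<open>1 - z\<close> moves the differences onto \<open>b\<close>. As the
  powers of z have norm 1, only the boundary values and the total variation of \<open>b\<close>
  remain.\<close>

lemma Abel_summation_bound:
  fixes z :: complex and b :: "nat \<Rightarrow> complex"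
  assumes z: "norm z = 1" "z \<noteq> 1"
  shows "norm (\<Sum>k<N. z ^ Suc k * b k) \<le>
    (norm (b 0) + norm (b N) + (\<Sum>k<N. norm (b (Suc k) - b k))) / norm (1 - z)"
proof -
  have eq: "(1 - z) * (\<Sum>k<N. z ^ Suc k * b k) =
      z * b 0 - z ^ Suc N * b N + (\<Sum>k<N. z ^ Suc (Suc k) * (b (Suc k) - b k))"
  proof (induction N)
    case (Suc N)
    have "(1 - z) * (\<Sum>k<Suc N. z ^ Suc k * b k) =
        (1 - z) * (\<Sum>k<N. z ^ Suc k * b k) + (1 - z) * (z ^ Suc N * b N)"
      by (simp only: sum.lessThan_Suc distrib_left)
    thus ?case
      unfolding Suc.IH by (simp only: sum.lessThan_Suc) (simp add: algebra_simps)
  qed simp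
  have "norm (\<Sum>k<N. z ^ Suc (Suc k) * (b (Suc k) - b k)) \<le> (\<Sum>k<N. norm (b (Suc k) - b k))"
    by (rule sum_norm_le) (simp add: norm_mult norm_power z)
  moreover have "norm (z * b 0 - z ^ Suc N * b N) \<le> norm (b 0) + norm (b N)"
    by (rule order_trans[OF norm_triangle_ineq4]) (simp add: norm_mult norm_power z)
  ultimately have "norm ((1 - z) * (\<Sum>k<N. z ^ Suc k * b k)) \<le>
      norm (b 0) + norm (b N) + (\<Sum>k<N. norm (b (Suc k) - b k))"
    unfolding eq by (intro order_trans[OF norm_triangle_ineq] add_mono)
  moreover have "norm (1 - z) > 0" using z by simp
  ultimately show ?thesis by (simp only: norm_mult pos_le_divide_eq mult.commute)
qed

text \<open>The term is \<open>2 Re (z^(n+1) / (x + i y))\<close> with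
  \<open>z = cis (2 pi a)\<close> and \<open>y = 2 pi (n+1)\<close>. In the Abel bound the two
  boundary values contribute at most \<open>1/x\<close> each and the variation at most
  \<open>2/x\<close>; the factor 2 before Re raises 4 to 8.\<close>

lemma fourier_exp_partial_sum_bound:
  assumes a: "0 < a" "a < 1" and x: "x > 0"
  shows "\<bar>\<Sum>n<N. fourier_exp_term x a n\<bar> \<le> 8 / norm (1 - cis (2 * pi * a)) / x"
proof -
  define z where "z = cis (2 * pi * a)"
  have z: "norm z = 1" "z \<noteq> 1"
  proof -
    have "cos (2 * pi * a) \<noteq> 1"
    proof
      assume "cos (2 * pi * a) = 1"
      hence "sin (pi * a) = 0"
        using cos_double_sin[of "pi * a"] by (simp add: mult_ac)
      moreover have "sin (pi * a) > 0" using a by (intro sin_gt_zero) auto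
      ultimately show False by simp
    qed
    thus "z \<noteq> 1" by (auto simp: z_def complex_eq_iff)
  qed (simp add: z_def)
  define y where "y = (\<lambda>k. 2 * pi * real (Suc k))"
  have y: "y k > 0" for k by (simp add: y_def)
  define b where "b = (\<lambda>k. 1 / Complex x (y k))"
  have term_eq: "fourier_exp_term x a n = 2 * Re (z ^ Suc n * b n)" for n
  proof -
    have "z ^ Suc n = cis (2*pi*real (Suc n)*a)"
      unfolding z_def Complex.DeMoivre by (simp add: mult_ac)
    hence "Re (z ^ Suc n * b n) =
       (x * cos (2*pi*real (Suc n)*a) + y n * sin (2*pi*real (Suc n)*a)) / (x\<^sup>2 + (y n)\<^sup>2)"
      by (simp only: b_def) (simp add: Re_divide add_divide_distrib mult_ac)
    thus ?thesis by (simp only: fourier_exp_term_def y_def)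
  qed
  \<comment> \<open>Replacing the modulus by \<open>x + y\<close> up to \<open>sqrt 2\<close> turns
    the bound on consecutive differences of \<open>b\<close> into a telescoping sum.\<close>
  have norm_ge: "x + y k \<le> sqrt 2 * norm (Complex x (y k))" for k
  proof -
    have "(x + y k)\<^sup>2 \<le> 2 * (x\<^sup>2 + (y k)\<^sup>2)"
      using zero_le_power2[of "x - y k"] by (simp add: power2_eq_square algebra_simps)
    thus ?thesis
      unfolding complex_norm real_sqrt_mult [symmetric] complex.sel by (rule real_le_rsqrt)
  qed
  have norm_b: "norm (b k) \<le> 1 / x" for k
  proof -
    have "x \<le> norm (Complex x (y k))" using complex_Re_le_cmod[of "Complex x (y k)"] by simp
    thus ?thesis using x by (simp add: b_def norm_divide frac_le)
  qed
  have diff: "norm (b (Suc k) - b k) \<le> 2 * (1 / (x + y k) - 1 / (x + y (Suc k)))" for k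
  proof -
    define p q where "p = norm (Complex x (y k))" and "q = norm (Complex x (y (Suc k)))"
    have nz: "Complex x (y j) \<noteq> 0" for j using x by (simp add: complex_eq_iff)
    have pq: "p > 0" "q > 0" using nz by (auto simp: p_def q_def)
    have "b (Suc k) - b k = (Complex x (y k) - Complex x (y (Suc k))) / (Complex x (y k) * Complex x (y (Suc k)))"
      using nz by (simp add: b_def diff_frac_eq mult_ac)
    moreover have "norm (Complex x (y k) - Complex x (y (Suc k))) = y (Suc k) - y k"
      by (simp add: cmod_def y_def)
    ultimately have eq: "norm (b (Suc k) - b k) = (y (Suc k) - y k) / (p * q)"
      by (simp only: norm_divide norm_mult p_def q_def)
    have pos: "x + y k > 0" "x + y (Suc k) > 0"
      using x y[of k] y[of "Suc k"] by simp_all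
    have y_le: "y k \<le> y (Suc k)" by (simp add: y_def)
    have "(x + y k) * (x + y (Suc k)) \<le> (sqrt 2 * p) * (sqrt 2 * q)"
      unfolding p_def q_def using x y[of k] y[of "Suc k"]
      by (intro mult_mono norm_ge) auto
    also have "\<dots> = 2 * (p * q)" by simp
    finally have "(y (Suc k) - y k) / (p * q) \<le> (y (Suc k) - y k) / ((x + y k) * (x + y (Suc k)) / 2)"
      using pos pq y_le by (intro divide_left_mono mult_pos_pos divide_pos_pos) auto
    also have "\<dots> = 2 * (1 / (x + y k) - 1 / (x + y (Suc k)))"
      using pos by (simp add: divide_simps)
    finally show ?thesis by (simp only: eq)
  qed
  have "(\<Sum>k<N. norm (b (Suc k) - b k)) \<le> (\<Sum>k<N. 2 * (1 / (x + y k) - 1 / (x + y (Suc k))))"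
    by (intro sum_mono diff)
  also have "\<dots> = 2 * (1 / (x + y 0) - 1 / (x + y N))"
    by (induction N) simp_all
  also have "\<dots> \<le> 2 * (1 / x)"
  proof -
    have "1 / (x + y 0) \<le> 1 / x" "1 / (x + y N) \<ge> 0"
      using x y[of 0] y[of N] by (auto simp: frac_le)
    moreover have "2 * (p - q) \<le> 2 * r" if "p \<le> r" "q \<ge> 0" for p q r :: real
      using that by simp
    ultimately show ?thesis by blast
  qed
  finally have "norm (b 0) + norm (b N) + (\<Sum>k<N. norm (b (Suc k) - b k)) \<le> 4 / x"
    using norm_b[of 0] norm_b[of N] by (simp add: field_simps)
  hence "norm (\<Sum>k<N. z ^ Suc k * b k) \<le> 4 / x / norm (1 - z)"
    by (intro order_trans[OF Abel_summation_bound[OF z]] divide_right_mono) auto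
  moreover have "\<bar>Re (\<Sum>k<N. z ^ Suc k * b k)\<bar> \<le> norm (\<Sum>k<N. z ^ Suc k * b k)"
    by (rule abs_Re_le_cmod)
  moreover have "(\<Sum>n<N. fourier_exp_term x a n) = 2 * Re (\<Sum>k<N. z ^ Suc k * b k)"
    by (simp only: term_eq sum_distrib_left Re_sum)
  ultimately have "\<bar>\<Sum>n<N. fourier_exp_term x a n\<bar> \<le> 2 * (4 / x / norm (1 - z))"
    by (simp add: abs_mult)
  thus ?thesis by (simp add: z_def field_simps)
qed

section \<open>Real partial fractions of coth and cosech\<close>

lemma coth_partial_fractions_Re:
  assumes "Re c \<noteq> 0"
  shows "(\<lambda>n. 1 / ((of_nat (Suc n))\<^sup>2 + c\<^sup>2)) sums
    ((of_real pi * c * cosh (of_real pi * c) / sinh (of_real pi * c) - 1) / (2 * c\<^sup>2))"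
proof (rule coth_partial_fractions)
  show "\<i> * c \<notin> \<int>"
  proof
    assume "\<i> * c \<in> \<int>"
    then obtain k where "\<i> * c = of_int k" by (elim Ints_cases)
    hence "Im (\<i> * c) = 0" by simp
    thus False using assms by simp
  qed
qed

lemma coth_partial_fractions_real:
  fixes c :: real
  assumes "c > 0"
  shows "(\<lambda>n. 1 / ((real (Suc n))\<^sup>2 + c\<^sup>2)) sums
    ((pi * c * cosh (pi * c) / sinh (pi * c) - 1) / (2 * c\<^sup>2))"
proof -
  have "cosh (of_real u) = complex_of_real (cosh u)" "sinh (of_real u) = complex_of_real (sinh u)" for u
    by (simp_all add: cosh_field_def sinh_field_def flip: exp_of_real)
  hence "cosh (of_real pi * of_real c) = complex_of_real (cosh (pi * c))"
        "sinh (of_real pi * of_real c) = complex_of_real (sinh (pi * c))"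
    by (metis of_real_mult)+
  moreover have "(\<lambda>n. 1 / ((of_nat (Suc n))\<^sup>2 + (complex_of_real c)\<^sup>2)) sums
    ((of_real pi * of_real c * cosh (of_real pi * of_real c) / sinh (of_real pi * of_real c) - 1) /
       (2 * (complex_of_real c)\<^sup>2))"
    using assms by (intro coth_partial_fractions_Re) simp
  ultimately have "(\<lambda>n. complex_of_real (1 / ((real (Suc n))\<^sup>2 + c\<^sup>2))) sums
    complex_of_real ((pi * c * cosh (pi * c) / sinh (pi * c) - 1) / (2 * c\<^sup>2))"
    by simp
  thus ?thesis by (simp only: sums_of_real_iff)
qed

text \<open>The alternating sum is twice the sum over even integers minus the sum over all. The even
  integers rescale to the coth series at \<open>c/2\<close>, and
  \<open>coth u - coth (2 u) = cosech (2 u)\<close> combines the two.\<close>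

lemma cosech_partial_fractions:
  fixes c :: real
  assumes c: "c > 0"
  shows "(\<lambda>n. (-1) ^ Suc n / ((real (Suc n))\<^sup>2 + c\<^sup>2)) sums ((pi * c / sinh (pi * c) - 1) / (2 * c\<^sup>2))"
proof -
  define g where "g = (\<lambda>n. 1 / ((real (Suc n))\<^sup>2 + c\<^sup>2))"
  define u where "u = pi * c / 2"
  have u: "sinh u > 0" "cosh u > 0" "pi * c = 2 * u" using c by (auto simp: u_def)
  have "(\<lambda>n. 1/4 * (1 / ((real (Suc n))\<^sup>2 + (c/2)\<^sup>2))) sums
      (1/4 * ((pi * (c/2) * cosh (pi * (c/2)) / sinh (pi * (c/2)) - 1) / (2 * (c/2)\<^sup>2)))"
    using c by (intro sums_mult coth_partial_fractions_real) simp
  \<comment> \<open>Position n belongs to the integer \<open>Suc n\<close>, so the even integers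
    \<open>2m + 2\<close> sit at the odd positions \<open>2m + 1\<close>.\<close>
  also have "(\<lambda>n. 1/4 * (1 / ((real (Suc n))\<^sup>2 + (c/2)\<^sup>2))) =
      (\<lambda>n. (\<lambda>n. if odd n then g n else 0) (2 * n + 1))"
    by (auto simp: g_def fun_eq_iff power2_eq_square field_simps)
  also have "1/4 * ((pi * (c/2) * cosh (pi * (c/2)) / sinh (pi * (c/2)) - 1) / (2 * (c/2)\<^sup>2)) =
      (u * cosh u / sinh u - 1) / (2 * c\<^sup>2)"
    using c by (simp add: u_def power2_eq_square diff_divide_distrib)
  finally have "(\<lambda>n. if odd n then g n else 0) sums ((u * cosh u / sinh u - 1) / (2 * c\<^sup>2))"
    by (subst (asm) sums_mono_reindex) (auto simp: strict_mono_def elim!: oddE)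
  hence "(\<lambda>n. 2 * (if odd n then g n else 0) - g n) sums
      (2 * ((u * cosh u / sinh u - 1) / (2 * c\<^sup>2)) -
        (pi * c * cosh (pi * c) / sinh (pi * c) - 1) / (2 * c\<^sup>2))"
    unfolding g_def by (intro sums_diff sums_mult coth_partial_fractions_real c)
  also have "(\<lambda>n. 2 * (if odd n then g n else 0) - g n) = (\<lambda>n. (-1) ^ Suc n / ((real (Suc n))\<^sup>2 + c\<^sup>2))"
    by (auto simp: g_def fun_eq_iff)
  also have "2 * ((u * cosh u / sinh u - 1) / (2 * c\<^sup>2)) -
        (pi * c * cosh (pi * c) / sinh (pi * c) - 1) / (2 * c\<^sup>2) =
      (2 * u * (cosh u / sinh u - cosh (2 * u) / sinh (2 * u)) - 1) / (2 * c\<^sup>2)"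
    using c by (simp add: u field_simps)
  also have "cosh u / sinh u - cosh (2 * u) / sinh (2 * u) = 1 / sinh (2 * u)"
    using u cosh_square_eq[of u]
    by (simp add: cosh_double sinh_double divide_simps) (simp add: power2_eq_square)
  finally show ?thesis by (simp add: u)
qed

section \<open>Fourier expansions of the exponential and the sawtooth\<close>

text \<open>Starting point for the transport: at 1/2 the sines vanish and the cosines alternate,
  leaving the cosech expansion at \<open>c = x / (2 pi)\<close>.\<close>

lemma fourier_exp_term_half_sums:
  assumes x: "x > 0"
  shows "fourier_exp_term x (1/2) sums (1 / (2 * sinh (x/2)) - 1 / x)"
proof -
  define c where "c = x / (2 * pi)"
  have c: "c > 0" "x = 2 * pi * c" using x by (auto simp: c_def)
  have "(\<lambda>n. c / pi * ((-1) ^ Suc n / ((real (Suc n))\<^sup>2 + c\<^sup>2))) sums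
      (c / pi * ((pi * c / sinh (pi * c) - 1) / (2 * c\<^sup>2)))"
    by (intro sums_mult cosech_partial_fractions c)
  also have "(\<lambda>n. c / pi * ((-1) ^ Suc n / ((real (Suc n))\<^sup>2 + c\<^sup>2))) = fourier_exp_term x (1/2)"
  proof
    fix n
    have "2 * pi * real (Suc n) * (1/2) = pi * real (Suc n)" by simp
    hence "fourier_exp_term x (1/2) n =
        2 * (x * (-1) ^ Suc n) / (x\<^sup>2 + (2 * pi * real (Suc n))\<^sup>2)"
      unfolding fourier_exp_term_def using cos_npi[of "Suc n"] sin_npi[of "Suc n"]
      by (simp only: mult.commute) simp
    also have "\<dots> = 4 * pi * c * (-1) ^ Suc n / ((2 * pi)\<^sup>2 * ((real (Suc n))\<^sup>2 + c\<^sup>2))"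
      unfolding c(2) by (simp only: power_mult_distrib distrib_left) (simp add: add_ac)
    also have "\<dots> = c / pi * ((-1) ^ Suc n / ((real (Suc n))\<^sup>2 + c\<^sup>2))"
      by (simp only: power2_eq_square[of "2 * pi"]) simp
    finally show "c / pi * ((-1) ^ Suc n / ((real (Suc n))\<^sup>2 + c\<^sup>2)) = fourier_exp_term x (1/2) n" ..
  qed
  also have "c / pi * ((pi * c / sinh (pi * c) - 1) / (2 * c\<^sup>2)) = 1 / (2 * sinh (x/2)) - 1 / x"
    using c by (simp add: power2_eq_square field_simps)
  finally show ?thesis .
qed

text \<open>Transports the value at 1/2 to a with the antiderivative \<open>exp (x t) / x\<close>,
  which accounts for the term \<open>1 / x\<close> of index 0. Multiplying by
  \<open>exp (- x a)\<close> undoes the integrating factor.\<close>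

lemma fourier_exp_term_sums:
  assumes a: "0 < a" "a < 1" and x: "x > 0"
  shows "fourier_exp_term x a sums (exp (-(a * x)) / (1 - exp (-x)) - 1 / x)"
proof -
  define H where "H = (\<lambda>N. exp (x * (1/2)) * (\<Sum>n<N. fourier_exp_term x (1/2) n) + exp (x * (1/2)) / x)"
  have "(\<lambda>N. (exp (x * a) * (\<Sum>n<N. fourier_exp_term x a n) + exp (x * a) / x) - H N) \<longlonglongrightarrow> 0"
    unfolding H_def using x
    by (intro fourier_exp_partial_sum_transport[where E = "\<lambda>t. exp (x * t) / x"] a)
       (auto intro!: derivative_eq_intros)
  moreover have "H \<longlonglongrightarrow> exp (x * (1/2)) * (1 / (2 * sinh (x/2)) - 1 / x) + exp (x * (1/2)) / x"
    unfolding H_def using fourier_exp_term_half_sums[OF x]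
    by (intro tendsto_intros) (simp add: sums_def)
  ultimately have "(\<lambda>N. exp (- (x * a)) * ((exp (x * a) * (\<Sum>n<N. fourier_exp_term x a n) + exp (x * a) / x) - H N + H N) - 1 / x)
      \<longlonglongrightarrow> exp (- (x * a)) * (0 + (exp (x * (1/2)) * (1 / (2 * sinh (x/2)) - 1 / x) + exp (x * (1/2)) / x)) - 1 / x"
    by (intro tendsto_diff tendsto_mult tendsto_add tendsto_const)
  also have "(\<lambda>N. exp (- (x * a)) * ((exp (x * a) * (\<Sum>n<N. fourier_exp_term x a n) + exp (x * a) / x) - H N + H N) - 1 / x) =
      (\<lambda>N. \<Sum>n<N. fourier_exp_term x a n)"
    by (simp add: fun_eq_iff distrib_left exp_minus)
  also have "exp (- (x * a)) * (0 + (exp (x * (1/2)) * (1 / (2 * sinh (x/2)) - 1 / x) + exp (x * (1/2)) / x)) - 1 / x =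
      exp (-(a * x)) * (exp (x/2) / (2 * sinh (x/2))) - 1 / x"
    by (simp add: algebra_simps)
  also have "exp (x/2) / (2 * sinh (x/2)) = 1 / (1 - exp (-x))"
  proof -
    have "exp (x/2) * exp (-x) = exp (-(x/2))" by (simp flip: exp_add)
    hence "2 * sinh (x/2) = exp (x/2) * (1 - exp (-x))"
      by (simp add: sinh_field_def right_diff_distrib)
    thus ?thesis by simp
  qed
  finally show ?thesis by (simp add: sums_def)
qed

text \<open>The transport at x = 0 with \<open>E t = t\<close>: all terms vanish at 1/2, so the sum
  at a is the negative of \<open>a - 1/2\<close>.\<close>

lemma sawtooth_sums:
  assumes a: "0 < a" "a < 1"
  shows "(\<lambda>n. sin (2*pi*real (Suc n)*a) / (pi * real (Suc n))) sums (1/2 - a)"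
proof -
  have eq: "fourier_exp_term 0 t n = sin (2*pi*real (Suc n)*t) / (pi * real (Suc n))" for t n
    unfolding fourier_exp_term_def by (simp add: power2_eq_square del: of_nat_Suc)
  have half: "fourier_exp_term 0 (1/2) n = 0" for n
  proof -
    have "2 * pi * real (Suc n) * (1/2) = real (Suc n) * pi" by simp
    thus ?thesis unfolding eq using sin_npi[of "Suc n"] by (simp only:)
  qed
  have "(\<lambda>N. (\<Sum>n<N. fourier_exp_term 0 a n) + a - 1/2) \<longlonglongrightarrow> 0"
    using fourier_exp_partial_sum_transport[where E = "\<lambda>t. t" and x = 0, OF a] half by simp
  hence "(\<lambda>N. ((\<Sum>n<N. fourier_exp_term 0 a n) + a - 1/2) + (1/2 - a)) \<longlonglongrightarrow> 0 + (1/2 - a)"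
    by (intro tendsto_add tendsto_const)
  thus ?thesis by (simp add: sums_def eq)
qed

section \<open>Closed form of the inner sums over m\<close>

text \<open>Addition formulas at \<open>h + i h\<close> with \<open>h = w/2\<close>. The squared
  modulus of the denominator is \<open>sinh^2 h + sin^2 h\<close>, half of
  \<open>cosh w - cos w\<close>; the numerators collapse to \<open>sinh h cosh h\<close> and
  \<open>- sin h cos h\<close>, halves of \<open>sinh w\<close> and \<open>- sin w\<close>.\<close>

lemma coth_diagonal:
  fixes w :: real
  assumes w: "w > 0"
  shows "cosh (Complex (w/2) (w/2)) / sinh (Complex (w/2) (w/2)) =
    Complex (sinh w / (cosh w - cos w)) (- sin w / (cosh w - cos w))"
proof -
  define h where "h = w / 2"
  define S C s c where "S = sinh h" "C = cosh h" "s = sin h" "c = cos h"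
  note defs = this
  have Cc: "C\<^sup>2 = S\<^sup>2 + 1" "c\<^sup>2 = 1 - s\<^sup>2"
    by (simp_all add: defs cosh_square_eq cos_squared_eq)
  have S: "S > 0" using w by (simp add: defs h_def)
  have w2: "w = 2 * h" by (simp add: h_def)
  have dbl: "sinh w = 2 * S * C" "sin w = 2 * s * c" "cosh w - cos w = 2 * (S\<^sup>2 + s\<^sup>2)"
    unfolding w2 by (simp_all add: defs sinh_double sin_double cosh_double cos_double cosh_square_eq cos_squared_eq)
  have sh: "sinh (Complex h h) = Complex (S * c) (C * s)"
    by (simp add: complex_eq_iff sinh_field_def cosh_field_def Re_exp Im_exp defs field_simps)
  have ch: "cosh (Complex h h) = Complex (C * c) (S * s)"
    by (simp add: complex_eq_iff cosh_field_def Re_exp Im_exp defs sinh_field_def field_simps)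
  have "S\<^sup>2 + s\<^sup>2 > 0" using S by (simp add: add_pos_nonneg)
  have n: "(S * c)\<^sup>2 + (C * s)\<^sup>2 = S\<^sup>2 + s\<^sup>2"
    by (simp add: power_mult_distrib Cc algebra_simps)
  have re: "C * c * (S * c) + S * s * (C * s) = S * C" 
  proof -
    have "C * c * (S * c) + S * s * (C * s) = S * C * (c\<^sup>2 + s\<^sup>2)"
      by (simp add: power2_eq_square algebra_simps)
    thus ?thesis by (simp add: Cc)
  qed
  have im: "S * s * (S * c) - C * c * (C * s) = - (s * c)"
  proof -
    have "S * s * (S * c) - C * c * (C * s) = (S\<^sup>2 - C\<^sup>2) * (s * c)"
      by (simp add: power2_eq_square algebra_simps)
    thus ?thesis by (simp add: Cc)
  qed
  show ?thesis
    unfolding h_def [symmetric] sh ch dbl complex_eq_iff Re_divide Im_divide complex.sel n re im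
    by (simp add: mult.assoc del: distrib_left_numeral)
qed

text \<open>The real part of \<open>e\<^sup>i\<^sup>v\<close> times the partial fractions of \<open>coth\<close> at \<open>c = (1 + i)u\<close>.\<close>
lemma lattice_sum_closed_form:
  fixes u v :: real
  assumes u: "u > 0"
  shows "(\<lambda>n. ((real (Suc n))\<^sup>2 * cos v + 2 * u\<^sup>2 * sin v) / (((real (Suc n))\<^sup>2)\<^sup>2 + (2 * u\<^sup>2)\<^sup>2)) sums
    (pi / (4 * u) * ((cos v * (sinh (2 * pi * u) - sin (2 * pi * u)) + sin v * (sinh (2 * pi * u) + sin (2 * pi * u))) /
        (cosh (2 * pi * u) - cos (2 * pi * u))) - sin v / (4 * u\<^sup>2))"
proof -
  define w where "w = 2 * pi * u"
  define A B where "A = sinh w / (cosh w - cos w)" and "B = sin w / (cosh w - cos w)"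
  define c where "c = Complex u u"
  have w: "w > 0" using u by (simp add: w_def)
  have c2: "c\<^sup>2 = Complex 0 (2 * u\<^sup>2)"
    by (simp add: c_def complex_eq_iff power2_eq_square)
  have c2_double: "2 * c\<^sup>2 = Complex 0 (4 * u\<^sup>2)"
    by (simp add: c2 complex_eq_iff)
  have pc: "of_real pi * c = Complex (w/2) (w/2)"
    by (simp add: c_def w_def complex_eq_iff)
  have "(\<lambda>n. cis v * (1 / ((of_nat (Suc n))\<^sup>2 + c\<^sup>2))) sums
    (cis v * ((of_real pi * c * cosh (of_real pi * c) / sinh (of_real pi * c) - 1) / (2 * c\<^sup>2)))"
    using u by (intro sums_mult coth_partial_fractions_Re) (simp add: c_def)
  also have "of_real pi * c * cosh (of_real pi * c) / sinh (of_real pi * c) =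
      Complex (w/2) (w/2) * Complex A (- B)"
    by (simp only: pc times_divide_eq_right [symmetric] mult.assoc [symmetric] coth_diagonal[OF w])
       (simp add: A_def B_def)
  finally have "(\<lambda>n. Re (cis v * (1 / ((of_nat (Suc n))\<^sup>2 + c\<^sup>2)))) sums
      Re (cis v * ((Complex (w/2) (w/2) * Complex A (- B) - 1) / (2 * c\<^sup>2)))"
    by (rule sums_Re)
  also have "(\<lambda>n. Re (cis v * (1 / ((of_nat (Suc n))\<^sup>2 + c\<^sup>2)))) =
     (\<lambda>n. ((real (Suc n))\<^sup>2 * cos v + 2 * u\<^sup>2 * sin v) / (((real (Suc n))\<^sup>2)\<^sup>2 + (2 * u\<^sup>2)\<^sup>2))"
  proof
    fix n
    have eq: "(of_nat (Suc n))\<^sup>2 + c\<^sup>2 = Complex ((real (Suc n))\<^sup>2) (2 * u\<^sup>2)"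
      by (simp add: c2 complex_eq_iff)
    show "Re (cis v * (1 / ((of_nat (Suc n))\<^sup>2 + c\<^sup>2))) =
        ((real (Suc n))\<^sup>2 * cos v + 2 * u\<^sup>2 * sin v) / (((real (Suc n))\<^sup>2)\<^sup>2 + (2 * u\<^sup>2)\<^sup>2)"
      unfolding eq by (simp add: Re_divide Im_divide add_divide_distrib mult_ac del: of_nat_Suc)
  qed
  \<comment> \<open>Here \<open>(1 + i)(A - i B) / i = (A - B) - i (A + B)\<close>, which pairs the
    cosine with \<open>sinh - sin\<close> and the sine with \<open>sinh + sin\<close>. The -1 gives
    the rational term \<open>- sin v / (4 u^2)\<close>.\<close>
  also have "Re (cis v * ((Complex (w/2) (w/2) * Complex A (- B) - 1) / (2 * c\<^sup>2))) =
      w / (8 * u\<^sup>2) * (cos v * (A - B) + sin v * (A + B)) - sin v / (4 * u\<^sup>2)"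
    using u by (simp only: c2_double) (simp add: Re_divide Im_divide power2_eq_square field_simps)
  also have "w / (8 * u\<^sup>2) = pi / (4 * u)"
    using u by (simp add: w_def power2_eq_square)
  also have "cos v * (A - B) + sin v * (A + B) =
     (cos v * (sinh w - sin w) + sin v * (sinh w + sin w)) / (cosh w - cos w)"
    by (simp add: A_def B_def add_divide_distrib diff_divide_distrib right_diff_distrib distrib_left)
  finally show ?thesis by (simp only: w_def)
qed

lemma fourier_exp_term_lattice_sums:
  fixes \<alpha> \<beta> a :: real
  assumes \<alpha>: "\<alpha> > 0" and \<beta>: "\<beta> > 0" and prod: "\<alpha> * \<beta> = 4 * pi ^ 3"
  shows "(\<lambda>m. fourier_exp_term (\<alpha> * (real (Suc m))\<^sup>2) a n) sums
    (sqrt pi / (2 * sqrt \<alpha>) *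
       (cos (2*pi*real (Suc n)*a) / sqrt (real (Suc n)) *
           ((sinh (sqrt (real (Suc n)*\<beta>)) - sin (sqrt (real (Suc n)*\<beta>))) /
            (cosh (sqrt (real (Suc n)*\<beta>)) - cos (sqrt (real (Suc n)*\<beta>)))) +
        sin (2*pi*real (Suc n)*a) / sqrt (real (Suc n)) *
           ((sinh (sqrt (real (Suc n)*\<beta>)) + sin (sqrt (real (Suc n)*\<beta>))) /
            (cosh (sqrt (real (Suc n)*\<beta>)) - cos (sqrt (real (Suc n)*\<beta>)))))
     - 1/2 * (sin (2*pi*real (Suc n)*a) / (pi * real (Suc n))))"
proof -
  define k where "k = real (Suc n)"
  define v where "v = 2 * pi * k * a"
  \<comment> \<open>Chosen so that \<open>2 pi k = \<alpha> * (2 u^2)\<close>; then a power of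
    \<alpha> factors out of the term at \<open>\<alpha> * m^2\<close>.\<close>
  define u where "u = sqrt (pi * k / \<alpha>)"
  have k: "k > 0" by (simp add: k_def)
  have u: "u > 0" using \<alpha> k by (simp add: u_def)
  have u2: "\<alpha> * u\<^sup>2 = pi * k" using \<alpha> k by (simp add: u_def)
  \<comment> \<open>The relation between \<alpha> and \<beta> enters here and makes the argument of
    the hyperbolic functions \<open>sqrt (k * \<beta>)\<close>.\<close>
  have w: "2 * pi * u = sqrt (k * \<beta>)"
  proof (rule sym, rule real_sqrt_unique)
    have "\<alpha> * (2 * pi * u)\<^sup>2 = 4 * pi\<^sup>2 * (\<alpha> * u\<^sup>2)" by (simp add: power_mult_distrib)
    also have "\<dots> = \<alpha> * (k * \<beta>)" unfolding u2 using prod by (simp add: power2_eq_square power3_eq_cube)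
    finally show "(2 * pi * u)\<^sup>2 = k * \<beta>" using \<alpha> by simp
  qed (use u in simp)
  define s d where "s = sinh (2 * pi * u) - sin (2 * pi * u)" and "d = cosh (2 * pi * u) - cos (2 * pi * u)"
  define r where "r = sinh (2 * pi * u) + sin (2 * pi * u)"
  have "(\<lambda>m. 2 / \<alpha> * (((real (Suc m))\<^sup>2 * cos v + 2 * u\<^sup>2 * sin v) / (((real (Suc m))\<^sup>2)\<^sup>2 + (2 * u\<^sup>2)\<^sup>2))) sums
     (2 / \<alpha> * (pi / (4 * u) * ((cos v * s + sin v * r) / d) - sin v / (4 * u\<^sup>2)))"
    unfolding s_def d_def r_def by (intro sums_mult lattice_sum_closed_form u)
  also have "(\<lambda>m. 2 / \<alpha> * (((real (Suc m))\<^sup>2 * cos v + 2 * u\<^sup>2 * sin v) / (((real (Suc m))\<^sup>2)\<^sup>2 + (2 * u\<^sup>2)\<^sup>2))) =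
      (\<lambda>m. fourier_exp_term (\<alpha> * (real (Suc m))\<^sup>2) a n)"
  proof
    fix m
    define M where "M = (real (Suc m))\<^sup>2"
    have "2 * pi * k = \<alpha> * (2 * u\<^sup>2)" using u2 by simp
    hence "fourier_exp_term (\<alpha> * M) a n =
        2 * (\<alpha> * M * cos v + \<alpha> * (2 * u\<^sup>2) * sin v) / ((\<alpha> * M)\<^sup>2 + (\<alpha> * (2 * u\<^sup>2))\<^sup>2)"
      by (simp only: fourier_exp_term_def v_def k_def)
    also have "\<dots> = \<alpha> * (2 * (M * cos v + 2 * u\<^sup>2 * sin v)) / (\<alpha> * (\<alpha> * (M\<^sup>2 + (2 * u\<^sup>2)\<^sup>2)))"
      by (simp only: power_mult_distrib power2_eq_square[of \<alpha>]) (simp add: algebra_simps)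
    also have "\<dots> = 2 / \<alpha> * ((M * cos v + 2 * u\<^sup>2 * sin v) / (M\<^sup>2 + (2 * u\<^sup>2)\<^sup>2))"
      using \<alpha> by simp
    finally show "2 / \<alpha> * (((real (Suc m))\<^sup>2 * cos v + 2 * u\<^sup>2 * sin v) / (((real (Suc m))\<^sup>2)\<^sup>2 + (2 * u\<^sup>2)\<^sup>2)) =
        fourier_exp_term (\<alpha> * (real (Suc m))\<^sup>2) a n"
      by (simp only: M_def)
  qed
  also have "2 / \<alpha> * (pi / (4 * u) * ((cos v * s + sin v * r) / d) - sin v / (4 * u\<^sup>2)) =
      pi / (2 * (\<alpha> * u)) * ((cos v * s + sin v * r) / d) - 1/2 * (sin v / (\<alpha> * u\<^sup>2))"
    by (simp add: right_diff_distrib)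
  also have "pi / (2 * (\<alpha> * u)) = sqrt pi / (2 * sqrt \<alpha>) * (1 / sqrt k)"
  proof -
    have "\<alpha> * u = sqrt \<alpha> * (sqrt pi * sqrt k)"
      using \<alpha> by (simp add: u_def real_sqrt_divide real_sqrt_mult) (simp add: field_simps)
    moreover have "pi = sqrt pi * sqrt pi" by simp
    ultimately show ?thesis using \<alpha> k by (simp add: field_simps)
  qed
  also have "sqrt pi / (2 * sqrt \<alpha>) * (1 / sqrt k) * ((cos v * s + sin v * r) / d) =
      sqrt pi / (2 * sqrt \<alpha>) * (cos v / sqrt k * (s / d) + sin v / sqrt k * (r / d))"
    by (simp add: add_divide_distrib distrib_left)
  finally show ?thesis
    unfolding u2 s_def r_def d_def w by (simp only: v_def k_def)
qed

section \<open>Interchange of the two summations\<close>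

text \<open>Convergence of the combined series is a conclusion of the interchange, which is why T is
  obtained rather than given; the two series are separated afterwards.\<close>

lemma exp_series_transformation:
  fixes \<alpha> \<beta> a :: real
  assumes \<alpha>: "\<alpha> > 0" and \<beta>: "\<beta> > 0" and prod: "\<alpha> * \<beta> = 4 * pi ^ 3"
    and a: "0 < a" "a < 1"
  defines "c \<equiv> \<lambda>n. cos (2*pi*real (Suc n)*a) / sqrt (real (Suc n)) *
           ((sinh (sqrt (real (Suc n)*\<beta>)) - sin (sqrt (real (Suc n)*\<beta>))) /
            (cosh (sqrt (real (Suc n)*\<beta>)) - cos (sqrt (real (Suc n)*\<beta>))))"
    and "s \<equiv> \<lambda>n. sin (2*pi*real (Suc n)*a) / sqrt (real (Suc n)) *
           ((sinh (sqrt (real (Suc n)*\<beta>)) + sin (sqrt (real (Suc n)*\<beta>))) /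
            (cosh (sqrt (real (Suc n)*\<beta>)) - cos (sqrt (real (Suc n)*\<beta>))))"
    and "f \<equiv> \<lambda>n. exp (-(a * (real (Suc n))\<^sup>2 * \<alpha>)) / (1 - exp (-((real (Suc n))\<^sup>2 * \<alpha>)))"
  obtains T where "(\<lambda>n. c n + s n) sums T"
    and "f sums (1/2 * (a - 1/2) + pi\<^sup>2 / (6*\<alpha>) + sqrt pi / (2 * sqrt \<alpha>) * T)"
proof -
  define x where "x = (\<lambda>m. \<alpha> * (real (Suc m))\<^sup>2)"
  have x: "x m > 0" for m using \<alpha> by (simp add: x_def)
  define L where "L = 8 / norm (1 - cis (2 * pi * a))"
  define F where "F = (\<lambda>m N. \<Sum>n<N. fourier_exp_term (x m) a n)"
  define \<sigma> where "\<sigma> = (\<lambda>n. sin (2*pi*real (Suc n)*a) / (pi * real (Suc n)))"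
  define K where "K = sqrt pi / (2 * sqrt \<alpha>)"
  have K: "K > 0" using \<alpha> by (simp add: K_def)
  \<comment> \<open>The scaled Basel sum is both the contribution of index 0 and, up to the factor
    \<open>L\<close>, the dominating series.\<close>
  have inv_x: "(\<lambda>m. 1 / x m) sums (pi\<^sup>2 / (6*\<alpha>))"
  proof -
    have "(\<lambda>m. 1 / \<alpha> * (1 / (real (Suc m))\<^sup>2)) sums (1 / \<alpha> * (pi\<^sup>2 / 6))"
      using inverse_squares_sums by (intro sums_mult) (simp add: add.commute)
    moreover have "1 / \<alpha> * (1 / (real (Suc m))\<^sup>2) = 1 / x m" for m
      by (simp add: x_def)
    moreover have "1 / \<alpha> * (pi\<^sup>2 / 6) = pi\<^sup>2 / (6*\<alpha>)" by simp
    ultimately show ?thesis by (simp only:)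
  qed
  have F_sums: "(\<lambda>m. F m N) sums (\<Sum>n<N. K * (c n + s n) - 1/2 * \<sigma> n)" for N
    unfolding F_def x_def K_def c_def s_def \<sigma>_def
    by (intro sums_sum fourier_exp_term_lattice_sums \<alpha> \<beta> prod)
  have F_lim: "F m \<longlonglongrightarrow> f m - 1 / x m" for m
  proof -
    have "f m = exp (-(a * x m)) / (1 - exp (- x m))"
      by (simp only: f_def x_def) (simp add: mult_ac)
    thus ?thesis
      using fourier_exp_term_sums[OF a x[of m]] by (simp only: F_def sums_def)
  qed
  have F_bound: "norm (F m N) \<le> L * (1 / x m)" for m N
    using fourier_exp_partial_sum_bound[OF a x, of m N] by (simp add: F_def L_def)
  have sm: "summable (\<lambda>m. L * (1 / x m))"
    using inv_x by (intro summable_mult) (auto simp: sums_iff)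
  have F_bound': "\<forall>\<^sub>F (m, N) in at_top \<times>\<^sub>F sequentially. norm (F m N) \<le> L * (1 / x m)"
    by (intro always_eventually allI) (simp only: case_prod_unfold F_bound)
  \<comment> \<open>\<open>L\<close> depends only on a, so the dominating series is independent of
    N.\<close>
  have tannery: "summable (\<lambda>m. norm (f m - 1 / x m)) \<and>
      ((\<lambda>N. \<Sum>m. F m N) \<longlonglongrightarrow> (\<Sum>m. f m - 1 / x m))"
    using tannerys_theorem[where a = F and b = "\<lambda>m. f m - 1 / x m", OF F_lim F_bound' sm sequentially_bot]
    by (rule conjunct2)
  define W where "W = (\<Sum>m. f m - 1 / x m)"
  have "(\<lambda>m. f m - 1 / x m) sums W"
    unfolding W_def by (rule summable_sums[OF summable_norm_cancel[OF tannery[THEN conjunct1]]])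
  from sums_add[OF this inv_x] have f_sums: "f sums (W + pi\<^sup>2 / (6*\<alpha>))" by simp
  \<comment> \<open>By \<open>F_sums\<close>, the sum over m of \<open>F m N\<close> is the N-th
    partial sum of this series, so the limit from Tannery's theorem is its convergence to
    \<open>W\<close>.\<close>
  have "(\<lambda>n. K * (c n + s n) - 1/2 * \<sigma> n) sums W"
    using tannery[THEN conjunct2] unfolding sums_unique[OF F_sums, symmetric] sums_def W_def .
  moreover have "\<sigma> sums (1/2 - a)"
    unfolding \<sigma>_def by (rule sawtooth_sums[OF a])
  \<comment> \<open>Adding back half the sawtooth series isolates \<open>c + s\<close>; its value
    supplies \<open>1/2 * (a - 1/2)\<close> in the final formula.\<close>
  ultimately have "(\<lambda>n. 1 / K * ((K * (c n + s n) - 1/2 * \<sigma> n) + 1/2 * \<sigma> n)) sums (1 / K * (W + 1/2 * (1/2 - a)))"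
    by (intro sums_mult sums_add)
  hence "(\<lambda>n. c n + s n) sums (1 / K * (W + 1/2 * (1/2 - a)))" using K by simp
  moreover have "W + pi\<^sup>2 / (6*\<alpha>) = 1/2 * (a - 1/2) + pi\<^sup>2 / (6*\<alpha>) + K * (1 / K * (W + 1/2 * (1/2 - a)))"
    using K by (simp add: diff_divide_distrib)
  ultimately show ?thesis using f_sums that unfolding K_def by (simp only:)
qed

section \<open>Separation of the two series and the case a = 1/2\<close>

theorem theorem1p22:
  fixes \<alpha> \<beta> :: real
  assumes "\<alpha> > 0" and "\<beta> > 0" and "\<alpha> * \<beta> = 4 * pi ^ 3"
  shows "(\<forall>a::real. 0 < a \<and> a < 1 \<longrightarrow>
      (\<exists>C S.
        ((\<lambda>n. cos (2*pi*real (Suc n)*a) / sqrt (real (Suc n)) *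
           ((sinh (sqrt (real (Suc n)*\<beta>)) - sin (sqrt (real (Suc n)*\<beta>))) /
            (cosh (sqrt (real (Suc n)*\<beta>)) - cos (sqrt (real (Suc n)*\<beta>))))) sums C) \<and>
        ((\<lambda>n. sin (2*pi*real (Suc n)*a) / sqrt (real (Suc n)) *
           ((sinh (sqrt (real (Suc n)*\<beta>)) + sin (sqrt (real (Suc n)*\<beta>))) /
            (cosh (sqrt (real (Suc n)*\<beta>)) - cos (sqrt (real (Suc n)*\<beta>))))) sums S) \<and>
        ((\<lambda>n. exp (-(a * (real (Suc n))^2 * \<alpha>)) / (1 - exp (-((real (Suc n))^2 * \<alpha>)))) sums
           (1/2 * (a - 1/2) + pi^2 / (6*\<alpha>) + sqrt pi / (2 * sqrt \<alpha>) * (C + S)))))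
    \<and> (\<exists>D.
        ((\<lambda>n. (-1)^(Suc n) / sqrt (real (Suc n)) *
           ((sinh (sqrt (real (Suc n)*\<beta>)) - sin (sqrt (real (Suc n)*\<beta>))) /
            (cosh (sqrt (real (Suc n)*\<beta>)) - cos (sqrt (real (Suc n)*\<beta>))))) sums D) \<and>
        ((\<lambda>n. 1 / sinh ((real (Suc n))^2 * \<alpha> / 2)) sums
           (pi^2 / (3*\<alpha>) + sqrt (pi/\<alpha>) * D)))"
proof -
  define p q where
    "p = (\<lambda>n. (sinh (sqrt (real (Suc n)*\<beta>)) - sin (sqrt (real (Suc n)*\<beta>))) /
            (cosh (sqrt (real (Suc n)*\<beta>)) - cos (sqrt (real (Suc n)*\<beta>))))" and
    "q = (\<lambda>n. (sinh (sqrt (real (Suc n)*\<beta>)) + sin (sqrt (real (Suc n)*\<beta>))) /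
            (cosh (sqrt (real (Suc n)*\<beta>)) - cos (sqrt (real (Suc n)*\<beta>))))"
  define c s where "c = (\<lambda>a n. cos (2*pi*real (Suc n)*a) / sqrt (real (Suc n)) * p n)"
    and "s = (\<lambda>a n. sin (2*pi*real (Suc n)*a) / sqrt (real (Suc n)) * q n)"
  define f where "f = (\<lambda>a n. exp (-(a * (real (Suc n))\<^sup>2 * \<alpha>)) / (1 - exp (-((real (Suc n))\<^sup>2 * \<alpha>))))"
  have main: "\<exists>T. (\<lambda>n. c a n + s a n) sums T \<and>
      f a sums (1/2 * (a - 1/2) + pi\<^sup>2 / (6*\<alpha>) + sqrt pi / (2 * sqrt \<alpha>) * T)" if "0 < a" "a < 1" for a
    unfolding c_def s_def f_def p_def q_def by (rule exp_series_transformation[OF assms that]) blast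
  have split: "\<exists>C S. c a sums C \<and> s a sums S \<and>
      f a sums (1/2 * (a - 1/2) + pi\<^sup>2 / (6*\<alpha>) + sqrt pi / (2 * sqrt \<alpha>) * (C + S))"
    if a: "0 < a" "a < 1" for a
  proof -
    obtain T where T: "(\<lambda>n. c a n + s a n) sums T"
      "f a sums (1/2 * (a - 1/2) + pi\<^sup>2 / (6*\<alpha>) + sqrt pi / (2 * sqrt \<alpha>) * T)"
      using main[OF a] by blast
    \<comment> \<open>The combined series at \<open>1 - a\<close> is the series of
      \<open>c a - s a\<close>; half the sum and half the difference with T give C and S.\<close>
    obtain T' where T': "(\<lambda>n. c (1 - a) n + s (1 - a) n) sums T'"
      using main[of "1 - a"] a by auto
    have "c (1 - a) n = c a n \<and> s (1 - a) n = - s a n" for n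
    proof -
      have "2*pi*real (Suc n)*(1 - a) = 2*pi*real (Suc n) - 2*pi*real (Suc n)*a"
        by (simp add: algebra_simps)
      moreover have "cos (2*pi*real (Suc n)) = 1" "sin (2*pi*real (Suc n)) = 0"
        using cos_int_2pin[of "int (Suc n)"] sin_int_2pin[of "int (Suc n)"] by (simp_all only: of_int_of_nat_eq)
      ultimately show ?thesis
        by (simp add: c_def s_def cos_diff sin_diff del: of_nat_Suc)
    qed
    hence T'': "(\<lambda>n. c a n - s a n) sums T'" using T' by simp
    have "c a sums ((T + T') / 2)"
      using sums_divide[OF sums_add[OF T(1) T''], of 2] by simp
    moreover have "s a sums ((T - T') / 2)"
      using sums_divide[OF sums_diff[OF T(1) T''], of 2] by simp
    moreover have "(T + T') / 2 + (T - T') / 2 = T" by (simp add: field_simps)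
    hence "f a sums (1/2 * (a - 1/2) + pi\<^sup>2 / (6*\<alpha>) + sqrt pi / (2 * sqrt \<alpha>) * ((T + T') / 2 + (T - T') / 2))"
      using T(2) by (simp only:)
    ultimately show ?thesis by (intro exI conjI)
  qed
  have half: "\<exists>D. (\<lambda>n. (-1)^(Suc n) / sqrt (real (Suc n)) * p n) sums D \<and>
      (\<lambda>n. 1 / sinh ((real (Suc n))\<^sup>2 * \<alpha> / 2)) sums (pi\<^sup>2 / (3*\<alpha>) + sqrt (pi/\<alpha>) * D)"
  proof -
    obtain T where T: "(\<lambda>n. c (1/2) n + s (1/2) n) sums T"
      "f (1/2) sums (1/2 * (1/2 - 1/2) + pi\<^sup>2 / (6*\<alpha>) + sqrt pi / (2 * sqrt \<alpha>) * T)"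
      using main[of "1/2"] by auto
    \<comment> \<open>The sines vanish at 1/2, so the combined series is already the alternating
      one.\<close>
    have "c (1/2) n + s (1/2) n = (-1)^(Suc n) / sqrt (real (Suc n)) * p n" for n
    proof -
      have "2*pi*real (Suc n)*(1/2) = real (Suc n) * pi" by simp
      thus ?thesis unfolding c_def s_def using cos_npi[of "Suc n"] sin_npi[of "Suc n"] by (simp only:)
    qed
    hence T_sums: "(\<lambda>n. (-1)^(Suc n) / sqrt (real (Suc n)) * p n) sums T"
      using T(1) by (simp only:)
    have "(\<lambda>n. 2 * f (1/2) n) sums (2 * (pi\<^sup>2 / (6*\<alpha>) + sqrt pi / (2 * sqrt \<alpha>) * T))"
      using T(2) by (intro sums_mult) simp
    \<comment> \<open>With \<open>y = m^2 * \<alpha> / 2\<close> for \<open>m = Suc n\<close>, the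
      summand is \<open>exp (-y) / (1 - exp (-2 y)) = 1 / (2 sinh y)\<close>, hence the
      doubling.\<close>
    moreover have "2 * f (1/2) n = 1 / sinh ((real (Suc n))\<^sup>2 * \<alpha> / 2)" for n
    proof -
      define y where "y = (real (Suc n))\<^sup>2 * \<alpha> / 2"
      have "exp (-y) * (2 * sinh y) = 1 - exp (- (2 * y))"
      proof -
        have "2 * sinh y = exp y - exp (-y)" by (simp add: sinh_field_def)
        hence "exp (-y) * (2 * sinh y) = exp (-y) * exp y - exp (-y) * exp (-y)"
          by (simp only: right_diff_distrib)
        thus ?thesis by (simp flip: exp_add)
      qed
      moreover have "f (1/2) n = exp (-y) / (1 - exp (- (2 * y)))"
        by (simp add: f_def y_def)
      ultimately have "f (1/2) n = exp (-y) / (exp (-y) * (2 * sinh y))" by (simp only:)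
      thus ?thesis unfolding y_def [symmetric] by simp
    qed
    moreover have "2 * (pi\<^sup>2 / (6*\<alpha>) + sqrt pi / (2 * sqrt \<alpha>) * T) = pi\<^sup>2 / (3*\<alpha>) + sqrt (pi/\<alpha>) * T"
      by (simp add: real_sqrt_divide distrib_left)
    ultimately have "(\<lambda>n. 1 / sinh ((real (Suc n))\<^sup>2 * \<alpha> / 2)) sums (pi\<^sup>2 / (3*\<alpha>) + sqrt (pi/\<alpha>) * T)"
      by (simp only:)
    with T_sums show ?thesis by (intro exI conjI)
  qed
  show ?thesis
  proof (intro conjI allI impI, goal_cases)
    case (1 a)
    thus ?case using split[of a] by (simp only: c_def s_def p_def q_def f_def)
  next
    case 2
    show ?case using half by (simp only: p_def)
  qed
qed

end
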